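(* The manifold $\mathbb{R}^2 \times \mathbb{S}^1$ does not decompose as a (possibly infinite) connected sum of spherical manifolds and $\mathbb{S}^2 \times \mathbb{S}^1$.
   Context: A spherical manifold is a quotient $\mathbb{S}^3/\Gamma$, where $\Gamma<O(4)$ is a subgroup of isometries acting freely on $\mathbb{S}^3$. Connected sum modelled on a graph: let $\mathcal{F}$ be a family of connected 3-manifolds. A 3-manifold $M$ decomposes as a (possibly infinite) connected sum of members of $\mathcal{F}$, modelled on a locally finite graph $\mathcal{G}$, if there is a map assigning to each vertex $v$ of $\mathcal{G}$ a copy $M_v$ of a manifold in $\mathcal{F}$ such that $M$ is diffeomorphic to the manifold constructed as follows: (1) for each vertex $v$, let $Y_v$ be obtained from $M_v$ by removing $\deg(v)$ 3-balls from its interior; (2) for each edge joining two vertices $v,v'$, glue two spherical boundary components from $\partial Y_v$ and $\partial Y_{v'}$ along an orientation-reversing diffeomorphism. Equivalently, there is a locally finite collection of pairwise disjoint embedded 2-spheres in $M$ such that cutting $M$ along them and capping off each new spherical boundary component by a 3-ball yields a disjoint collection of manifolds belonging to $\mathcal{F}$. The statement concerns connected sums modelled on any locally finite graph. *)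

theory Defs
  imports "HOL-Analysis.Analysis" "Graph_Theory.Bidirected_Digraph"
begin

section \<open>Smooth maps between Euclidean spaces\<close>

text \<open>
  \<open>ck_on k f U\<close> is meant for open \<open>U\<close>: \<open>f\<close> is \<open>k\<close> times continuously differentiable on \<open>U\<close>,
  expressed through iterated directional derivatives.
\<close>

fun ck_on :: "nat \<Rightarrow> ('a::euclidean_space \<Rightarrow> 'b::euclidean_space) \<Rightarrow> 'a set \<Rightarrow> bool" where
  "ck_on 0 f U \<longleftrightarrow> continuous_on U f"
| "ck_on (Suc k) f U \<longleftrightarrow>
     (\<forall>x\<in>U. f differentiable (at x)) \<and>
     (\<forall>v. ck_on k (\<lambda>x. frechet_derivative f (at x) v) U)"

definition smooth_on_open :: "'a set \<Rightarrow> ('a::euclidean_space \<Rightarrow> 'b::euclidean_space) \<Rightarrow> bool" where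
  "smooth_on_open U f \<longleftrightarrow> open U \<and> (\<forall>k. ck_on k f U)"

text \<open>On an arbitrary subset, smoothness means existence of local smooth extensions.\<close>

definition smooth_on_subset :: "'a set \<Rightarrow> ('a::euclidean_space \<Rightarrow> 'b::euclidean_space) \<Rightarrow> bool" where
  "smooth_on_subset S f \<longleftrightarrow>
     (\<forall>x\<in>S. \<exists>U F. x \<in> U \<and> smooth_on_open U F \<and> (\<forall>y\<in>S \<inter> U. F y = f y))"

text \<open>Jacobian determinant.\<close>

definition jac :: "(real^3 \<Rightarrow> real^3) \<Rightarrow> real^3 \<Rightarrow> real" where
  "jac F x = det (matrix (frechet_derivative F (at x)))"


section \<open>Smooth 3-manifolds\<close>

text \<open>
  A chart is a pair of its domain \<open>U\<close> and a coordinate map \<open>\<phi>\<close>, whose values outside \<open>U\<close> are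
  irrelevant. All manifolds below are without boundary.
\<close>

record 'a manifold3 =
  mtop :: "'a topology"
  charts :: "('a set \<times> ('a \<Rightarrow> real^3)) set"

abbreviation mspace :: "'a manifold3 \<Rightarrow> 'a set" where
  "mspace X \<equiv> topspace (mtop X)"

definition smooth_manifold3 :: "'a manifold3 \<Rightarrow> bool" where
  "smooth_manifold3 X \<longleftrightarrow>
     Hausdorff_space (mtop X) \<and> second_countable (mtop X) \<and>
     mspace X = (\<Union>(U, \<phi>)\<in>charts X. U) \<and>
     (\<forall>(U, \<phi>)\<in>charts X. openin (mtop X) U \<and> open (\<phi> ` U) \<and>
        homeomorphic_map (subtopology (mtop X) U) (top_of_set (\<phi> ` U)) \<phi>) \<and>
     (\<forall>(U, \<phi>)\<in>charts X. \<forall>(V, \<psi>)\<in>charts X.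
        smooth_on_open (\<phi> ` (U \<inter> V)) (\<psi> \<circ> inv_into U \<phi>))"

text \<open>An orientation is given by an atlas whose transition maps have positive Jacobian.\<close>

definition oriented_manifold3 :: "'a manifold3 \<Rightarrow> bool" where
  "oriented_manifold3 X \<longleftrightarrow>
     smooth_manifold3 X \<and>
     (\<forall>(U, \<phi>)\<in>charts X. \<forall>(V, \<psi>)\<in>charts X. \<forall>x\<in>\<phi> ` (U \<inter> V). jac (\<psi> \<circ> inv_into U \<phi>) x > 0)"

text \<open>
  Smoothness of \<open>f\<close> on an arbitrary subset \<open>S\<close> of \<open>X\<close>, again through local extensions (\<open>F\<close> is an
  extension of \<open>f\<close> in coordinates). This covers maps defined on closed balls, on their boundary
  spheres, and on domains with smooth boundary.
\<close>

definition smooth_map_on :: "'a manifold3 \<Rightarrow> 'b manifold3 \<Rightarrow> 'a set \<Rightarrow> ('a \<Rightarrow> 'b) \<Rightarrow> bool" where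
  "smooth_map_on X Y S f \<longleftrightarrow>
     S \<subseteq> mspace X \<and> f ` S \<subseteq> mspace Y \<and>
     (\<forall>p\<in>S. \<exists>(U, \<phi>)\<in>charts X. \<exists>(V, \<psi>)\<in>charts Y. \<exists>W F.
        p \<in> U \<and> \<phi> p \<in> W \<and> smooth_on_open W F \<and>
        (\<forall>x\<in>S \<inter> U. \<phi> x \<in> W \<longrightarrow> f x \<in> V \<and> \<psi> (f x) = F (\<phi> x)))"

definition diffeomorphism_on ::
    "'a manifold3 \<Rightarrow> 'b manifold3 \<Rightarrow> 'a set \<Rightarrow> 'b set \<Rightarrow> ('a \<Rightarrow> 'b) \<Rightarrow> bool" where
  "diffeomorphism_on X Y S T f \<longleftrightarrow>
     bij_betw f S T \<and> smooth_map_on X Y S f \<and> smooth_map_on Y X T (inv_into S f)"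

definition diffeomorphic :: "'a manifold3 \<Rightarrow> 'b manifold3 \<Rightarrow> bool" where
  "diffeomorphic X Y \<longleftrightarrow> (\<exists>f. diffeomorphism_on X Y (mspace X) (mspace Y) f)"

text \<open>
  The smooth structure induced on a 3-dimensional submanifold \<open>S\<close> of a Euclidean space: the
  charts are all diffeomorphisms from relatively open subsets of \<open>S\<close> onto open subsets of
  \<open>real^3\<close>.
\<close>

definition submanifold3 :: "'a::euclidean_space set \<Rightarrow> 'a manifold3" where
  "submanifold3 S =
     \<lparr> mtop = top_of_set S,
       charts = {(U, \<phi>). openin (top_of_set S) U \<and> open (\<phi> ` U) \<and> inj_on \<phi> U \<and>
                   smooth_on_subset U \<phi> \<and> smooth_on_subset (\<phi> ` U) (inv_into U \<phi>)} \<rparr>"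

definition R2_times_S1 :: "((real^2) \<times> complex) manifold3" where
  "R2_times_S1 = submanifold3 (UNIV \<times> sphere 0 1)"

definition S2_times_S1 :: "((real^3) \<times> complex) manifold3" where
  "S2_times_S1 = submanifold3 (sphere 0 1 \<times> sphere 0 1)"


section \<open>Quotients and spherical manifolds\<close>

definition quotient_topology :: "'a topology \<Rightarrow> ('a \<Rightarrow> 'b) \<Rightarrow> 'b topology" where
  "quotient_topology X q =
     topology (\<lambda>V. V \<subseteq> q ` topspace X \<and> openin X {x \<in> topspace X. q x \<in> V})"

lemma openin_quotient_topology:
  "openin (quotient_topology X q) V \<longleftrightarrow>
     V \<subseteq> q ` topspace X \<and> openin X {x \<in> topspace X. q x \<in> V}"
proof -
  have "istopology (\<lambda>V. V \<subseteq> q ` topspace X \<and> openin X {x \<in> topspace X. q x \<in> V})"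
    unfolding istopology_def
  proof (intro conjI allI impI; (elim conjE)?)
    fix S T
    assume "openin X {x \<in> topspace X. q x \<in> S}" "openin X {x \<in> topspace X. q x \<in> T}"
    then have "openin X ({x \<in> topspace X. q x \<in> S} \<inter> {x \<in> topspace X. q x \<in> T})" by blast
    also have "{x \<in> topspace X. q x \<in> S} \<inter> {x \<in> topspace X. q x \<in> T}
        = {x \<in> topspace X. q x \<in> S \<inter> T}" by blast
    finally show "openin X {x \<in> topspace X. q x \<in> S \<inter> T}" .
  next
    fix K
    assume K: "\<forall>k\<in>K. k \<subseteq> q ` topspace X \<and> openin X {x \<in> topspace X. q x \<in> k}"
    then have "openin X (\<Union>k\<in>K. {x \<in> topspace X. q x \<in> k})" by blast
    also have "(\<Union>k\<in>K. {x \<in> topspace X. q x \<in> k}) = {x \<in> topspace X. q x \<in> \<Union>K}" by blast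
    finally show "openin X {x \<in> topspace X. q x \<in> \<Union>K}" .
  qed auto
  then show ?thesis
    by (simp add: quotient_topology_def topology_inverse')
qed

definition subgroup_of_O4 :: "(real^4^4) set \<Rightarrow> bool" where
  "subgroup_of_O4 \<Gamma> \<longleftrightarrow>
     (\<forall>A\<in>\<Gamma>. orthogonal_matrix A) \<and> mat 1 \<in> \<Gamma> \<and>
     (\<forall>A\<in>\<Gamma>. \<forall>B\<in>\<Gamma>. A ** B \<in> \<Gamma>) \<and> (\<forall>A\<in>\<Gamma>. matrix_inv A \<in> \<Gamma>)"

definition acts_freely_on_S3 :: "(real^4^4) set \<Rightarrow> bool" where
  "acts_freely_on_S3 \<Gamma> \<longleftrightarrow> (\<forall>A\<in>\<Gamma>. \<forall>x\<in>sphere 0 1. A *v x = x \<longrightarrow> A = mat 1)"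

definition orbit :: "(real^4^4) set \<Rightarrow> real^4 \<Rightarrow> (real^4) set" where
  "orbit \<Gamma> x = (\<lambda>A. A *v x) ` \<Gamma>"

text \<open>
  The charts of the orbit space are those charts of the 3-sphere on which the projection is
  injective, pushed forward.
\<close>

definition S3_mod :: "(real^4^4) set \<Rightarrow> (real^4) set manifold3" where
  "S3_mod \<Gamma> =
     \<lparr> mtop = quotient_topology (top_of_set (sphere 0 1)) (orbit \<Gamma>),
       charts = {(orbit \<Gamma> ` U, \<phi> \<circ> inv_into U (orbit \<Gamma>)) | U \<phi>.
                   (U, \<phi>) \<in> charts (submanifold3 (sphere 0 1)) \<and> inj_on (orbit \<Gamma>) U} \<rparr>"

text \<open>
  An infinite \<open>\<Gamma>\<close> does not contribute: its orbits accumulate, so the projection is injective on no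
  nonempty open set, the orbit space has no nonempty charts, and nothing is diffeomorphic to it.
\<close>

definition spherical_manifold :: "'a manifold3 \<Rightarrow> bool" where
  "spherical_manifold X \<longleftrightarrow>
     smooth_manifold3 X \<and>
     (\<exists>\<Gamma>. subgroup_of_O4 \<Gamma> \<and> acts_freely_on_S3 \<Gamma> \<and> diffeomorphic X (S3_mod \<Gamma>))"

definition S2_times_S1_manifold :: "'a manifold3 \<Rightarrow> bool" where
  "S2_times_S1_manifold X \<longleftrightarrow> smooth_manifold3 X \<and> diffeomorphic X S2_times_S1"


section \<open>Connected sums modelled on graphs\<close>

text \<open>
  Graphs may have loops and multiple edges. An undirected edge is a pair of arcs \<open>e\<close>, \<open>arev e\<close>
  exchanged by the reversal of a bidirected digraph, so the degree of \<open>v\<close> is the number of arcs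
  with tail \<open>v\<close>, and a loop contributes two to it.
\<close>

definition locally_finite_graph :: "('v, 'e) pre_digraph \<Rightarrow> ('e \<Rightarrow> 'e) \<Rightarrow> bool" where
  "locally_finite_graph G arev \<longleftrightarrow>
     bidirected_digraph G arev \<and> (\<forall>v\<in>verts G. finite (out_arcs G v))"

definition closed_3ball :: "'m manifold3 \<Rightarrow> 'm set \<Rightarrow> bool" where
  "closed_3ball X B \<longleftrightarrow>
     (\<exists>f. diffeomorphism_on (submanifold3 (UNIV :: (real^3) set)) X (cball 0 1) B f)"

text \<open>One ball \<open>B e\<close> is chosen in \<open>X (tail G e)\<close> for each arc \<open>e\<close>.\<close>

definition disjoint_balls ::
    "('v, 'e) pre_digraph \<Rightarrow> ('v \<Rightarrow> 'm manifold3) \<Rightarrow> ('e \<Rightarrow> 'm set) \<Rightarrow> bool" where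
  "disjoint_balls G X B \<longleftrightarrow>
     (\<forall>e\<in>arcs G. closed_3ball (X (tail G e)) (B e)) \<and>
     (\<forall>v\<in>verts G. disjoint_family_on B (out_arcs G v))"

definition bsphere ::
    "('v, 'e) pre_digraph \<Rightarrow> ('v \<Rightarrow> 'm manifold3) \<Rightarrow> ('e \<Rightarrow> 'm set) \<Rightarrow> 'e \<Rightarrow> 'm set" where
  "bsphere G X B e = mtop (X (tail G e)) frontier_of B e"

definition piece ::
    "('v, 'e) pre_digraph \<Rightarrow> ('v \<Rightarrow> 'm manifold3) \<Rightarrow> ('e \<Rightarrow> 'm set) \<Rightarrow> 'v \<Rightarrow> 'm set" where
  "piece G X B v = mspace (X v) - (\<Union>e\<in>out_arcs G v. mtop (X v) interior_of B e)"

definition reverses_orientation_at ::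
    "'a manifold3 \<Rightarrow> 'b manifold3 \<Rightarrow> ('a \<Rightarrow> 'b) \<Rightarrow> 'a \<Rightarrow> bool" where
  "reverses_orientation_at X Y f p \<longleftrightarrow>
     (\<exists>(U, \<phi>)\<in>charts X. \<exists>(V, \<psi>)\<in>charts Y. p \<in> U \<and> f p \<in> V \<and>
        jac (\<psi> \<circ> f \<circ> inv_into U \<phi>) (\<phi> p) < 0)"

text \<open>
  Let \<open>P\<close> and \<open>Q\<close> be domains with smooth boundary in the oriented manifolds \<open>X\<close> and \<open>Y\<close>, and \<open>g\<close> a
  diffeomorphism from a boundary component \<open>S\<close> of \<open>P\<close> onto one of \<open>Q\<close>, where boundaries are
  oriented by the outward normal. A local extension of \<open>g\<close> that carries \<open>P\<close> into \<open>Q\<close> takes outward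
  to outward vectors, so \<open>g\<close> reverses the boundary orientation iff such extensions reverse the
  orientation of the ambient manifolds.
\<close>

definition reverses_boundary_orientation ::
    "'a manifold3 \<Rightarrow> 'b manifold3 \<Rightarrow> 'a set \<Rightarrow> 'b set \<Rightarrow> 'a set \<Rightarrow> ('a \<Rightarrow> 'b) \<Rightarrow> bool" where
  "reverses_boundary_orientation X Y P Q S g \<longleftrightarrow>
     (\<forall>p\<in>S. \<exists>N f. openin (mtop X) N \<and> p \<in> N \<and> smooth_map_on X Y N f \<and>
        (\<forall>x\<in>N \<inter> S. f x = g x) \<and> f ` (N \<inter> P) \<subseteq> Q \<and> reverses_orientation_at X Y f p)"

text \<open>
  The arcs \<open>e\<close> and \<open>arev e\<close> describe the same gluing, whence the last condition.
\<close>

definition gluing_maps ::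
    "('v, 'e) pre_digraph \<Rightarrow> ('e \<Rightarrow> 'e) \<Rightarrow> ('v \<Rightarrow> 'm manifold3) \<Rightarrow> ('e \<Rightarrow> 'm set)
      \<Rightarrow> ('e \<Rightarrow> 'm \<Rightarrow> 'm) \<Rightarrow> bool" where
  "gluing_maps G arev X B g \<longleftrightarrow>
     (\<forall>e\<in>arcs G.
        diffeomorphism_on (X (tail G e)) (X (head G e)) (bsphere G X B e) (bsphere G X B (arev e)) (g e) \<and>
        reverses_boundary_orientation (X (tail G e)) (X (head G e))
          (piece G X B (tail G e)) (piece G X B (head G e)) (bsphere G X B e) (g e) \<and>
        (\<forall>x\<in>bsphere G X B e. g (arev e) (g e x) = x))"

text \<open>
  The class of a point of the disjoint union of the pieces under the equivalence relation
  generated by the gluing maps. The generating relation is symmetric by the last condition of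
  \<open>gluing_maps\<close>.
\<close>

definition glue_class ::
    "('v, 'e) pre_digraph \<Rightarrow> ('v \<Rightarrow> 'm manifold3) \<Rightarrow> ('e \<Rightarrow> 'm set) \<Rightarrow> ('e \<Rightarrow> 'm \<Rightarrow> 'm)
      \<Rightarrow> 'v \<times> 'm \<Rightarrow> ('v \<times> 'm) set" where
  "glue_class G X B g p =
     {((tail G e, x), (head G e, g e x)) | e x. e \<in> arcs G \<and> x \<in> bsphere G X B e}\<^sup>* `` {p}"

definition glued_space ::
    "('v, 'e) pre_digraph \<Rightarrow> ('v \<Rightarrow> 'm manifold3) \<Rightarrow> ('e \<Rightarrow> 'm set) \<Rightarrow> ('e \<Rightarrow> 'm \<Rightarrow> 'm)
      \<Rightarrow> ('v \<times> 'm) set topology" where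
  "glued_space G X B g =
     quotient_topology
       (sum_topology (\<lambda>v. subtopology (mtop (X v)) (piece G X B v)) (verts G))
       (glue_class G X B g)"

text \<open>
  Gluing along boundary diffeomorphisms determines the topology of the result; its smooth
  structure is determined, up to diffeomorphism, by the requirement that the pieces be smoothly
  embedded. Embeddedness is required locally, because at a loop two boundary spheres of the same
  piece are identified with each other.
\<close>

definition glued_manifold ::
    "('v, 'e) pre_digraph \<Rightarrow> ('v \<Rightarrow> 'm manifold3) \<Rightarrow> ('e \<Rightarrow> 'm set) \<Rightarrow> ('e \<Rightarrow> 'm \<Rightarrow> 'm)
      \<Rightarrow> ('v \<times> 'm) set manifold3 \<Rightarrow> bool" where
  "glued_manifold G X B g Z \<longleftrightarrow>
     smooth_manifold3 Z \<and> mtop Z = glued_space G X B g \<and>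
     (\<forall>v\<in>verts G. \<forall>x\<in>piece G X B v.
        \<exists>N. openin (subtopology (mtop (X v)) (piece G X B v)) N \<and> x \<in> N \<and>
          diffeomorphism_on (X v) Z N ((\<lambda>y. glue_class G X B g (v, y)) ` N)
            (\<lambda>y. glue_class G X B g (v, y)))"

definition connected_sum_decomposition ::
    "('v, 'e) pre_digraph \<Rightarrow> ('e \<Rightarrow> 'e) \<Rightarrow> 'm manifold3 set \<Rightarrow> 'a manifold3 \<Rightarrow> bool" where
  "connected_sum_decomposition G arev \<F> M \<longleftrightarrow>
     (\<exists>X B g Z.
        (\<forall>v\<in>verts G. X v \<in> \<F> \<and> oriented_manifold3 (X v)) \<and>
        disjoint_balls G X B \<and>
        gluing_maps G arev X B g \<and>
        glued_manifold G X B g Z \<and>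
        diffeomorphic M Z)"

end

theory Submission
  imports Defs
begin

text \<open>
  Every summand is compact, being a quotient of \<open>S\<^sup>3\<close> or a copy of \<open>S\<^sup>2 \<times> S\<^sup>1\<close>. So each piece of the
  connected sum is compact, and any compact subset of the glued space lies in the union of finitely
  many pieces, because every class has at most two points and the graph is locally finite.

  Suppose that the glued space is \<open>\<real>\<^sup>2 \<times> S\<^sup>1\<close>. Choose finitely many pieces whose union \<open>A\<close> contains the core circle \<open>0 \<times> S\<^sup>1\<close>, and
  let \<open>B\<close> be the union of all other pieces. By local finiteness of the graph, \<open>A \<inter> B\<close> is a disjoint
  union of finitely many 2-spheres. Since \<open>A\<close> is bounded, \<open>B\<close> contains a circle \<open>b \<times> S\<^sup>1\<close> far out.
  So a finite union of spheres separates the core circle from a parallel copy of it, and this is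
  impossible for homotopical reasons:

  The projection \<open>p\<close> to \<open>S\<^sup>1\<close> has a continuous logarithm on each sphere, because a 2-sphere is simply
  connected, hence on \<open>A \<inter> B\<close>. By Tietze this logarithm extends to a continuous function \<open>H\<close>
  on the whole space. The map that is \<open>p\<close> on \<open>A\<close> and \<open>exp H\<close> on \<open>B\<close> is well-defined and continuous. It
  is the identity on the core circle and null-homotopic on \<open>b \<times> S\<^sup>1\<close>. The two circles are homotopic
  in \<open>\<real>\<^sup>2 \<times> S\<^sup>1\<close>, so the identity of the circle would be null-homotopic.

  This last argument is \<open>Borsukian_separator_impossible\<close>. The facts about the connected sum that feed
  it are \<open>compactin_subset_part\<close>, \<open>part_Int_complement\<close> and \<open>seam_parametrization\<close>. They rest
  on the continuity of smooth maps, on the description of the equivalence classes of the gluing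
  relation, and on invariance of domain, by which the frontier of an embedded closed ball is the
  image of the unit sphere.
\<close>

section \<open>Sets that cannot separate parallel circles\<close>

lemma Borsukian_Union_disjoint:
  fixes \<C> :: "'a::real_normed_vector set set"
  assumes "finite \<C>" "disjoint \<C>" "\<And>C. C \<in> \<C> \<Longrightarrow> closed C" "\<And>C. C \<in> \<C> \<Longrightarrow> Borsukian C"
  shows "Borsukian (\<Union>\<C>)"
  using assms
proof (induction \<C> rule: finite_induct)
  case empty
  then show ?case by (simp add: Borsukian_empty)
next
  case (insert C \<C>)
  have "C \<inter> \<Union>\<C> = {}"
    using insert.hyps(2) insert.prems(1) by (auto simp: pairwise_insert disjnt_def)
  moreover have "closed C" "closed (\<Union>\<C>)" "Borsukian C"
    using insert.prems insert.hyps(1) by auto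
  moreover have "Borsukian (\<Union>\<C>)"
    using insert.IH insert.prems by (auto simp: pairwise_insert)
  ultimately have "Borsukian (C \<union> \<Union>\<C>)"
    by (intro Borsukian_closed_Un closed_subset) auto
  then show ?case by simp
qed

lemma homotopic_with_canonI:
  assumes "continuous_on ({0..1::real} \<times> S) h" "\<And>t x. t \<in> {0..1} \<Longrightarrow> x \<in> S \<Longrightarrow> h (t, x) \<in> T"
  shows "homotopic_with_canon (\<lambda>_. True) S T (\<lambda>x. h (0, x)) (\<lambda>x. h (1, x))"
  unfolding homotopic_with_def using assms
  by (intro exI[of _ h]) (auto simp: continuous_map_in_subtopology Pi_iff)

text \<open>
  Radial projection turns a homotopy in the punctured plane into one in the circle, which would
  contract the circle.
\<close>

lemma circle_identity_essential:
  "\<not> homotopic_with_canon (\<lambda>_. True) (sphere 0 1) (-{0}) (\<lambda>w. w) (\<lambda>w. c :: complex)"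
proof
  let ?S = "sphere (0::complex) 1"
  assume "homotopic_with_canon (\<lambda>_. True) ?S (-{0}) (\<lambda>w. w) (\<lambda>w. c)"
  then have "homotopic_with_canon (\<lambda>_. True) ?S ?S (sgn \<circ> (\<lambda>w. w)) (sgn \<circ> (\<lambda>w. c))"
    by (rule homotopic_with_compose_continuous_map_left)
       (auto intro!: continuous_intros simp: sgn_div_norm norm_sgn)
  then have "homotopic_with_canon (\<lambda>_. True) ?S ?S id (\<lambda>w. sgn c)"
    by (rule homotopic_with_eq) (auto simp: sgn_div_norm)
  then have "contractible ?S"
    unfolding contractible_def by blast
  then show False by (simp add: contractible_sphere)
qed

text \<open>
  Two parallel circles in \<open>\<real>\<^sup>n \<times> S\<^sup>1\<close> cannot be separated by a set on which every map to the circle has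
  a continuous logarithm: replacing the projection by such a logarithm beyond the separator
  would change its degree from 1 to 0 along a homotopy between the circles.
\<close>

proposition Borsukian_separator_impossible:
  fixes A B :: "('a::euclidean_space \<times> complex) set"
  assumes "closed A" "closed B" and cover: "A \<union> B = UNIV \<times> sphere 0 1"
    and Bors: "Borsukian (A \<inter> B)"
    and a: "{a} \<times> sphere 0 1 \<subseteq> A" and b: "{b} \<times> sphere 0 1 \<subseteq> B"
  shows False
proof -
  let ?S = "sphere (0::complex) 1"
  have on_circle: "cmod (snd p) = 1" if "p \<in> A \<union> B" for p
    using that unfolding cover by auto
  have "snd p \<noteq> 0" if "p \<in> A \<inter> B" for p
    using on_circle[of p] that by fastforce
  then have "continuous_on (A \<inter> B) snd \<and> snd \<in> A \<inter> B \<rightarrow> -{0}"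
    by (auto intro: continuous_intros)
  then obtain h where h: "continuous_on (A \<inter> B) h" "\<And>p. p \<in> A \<inter> B \<Longrightarrow> snd p = exp (h p)"
    using Bors unfolding Borsukian_continuous_logarithm by metis
  moreover have "closedin (top_of_set UNIV) (A \<inter> B)"
    using \<open>closed A\<close> \<open>closed B\<close> by (simp add: closed_Int)
  ultimately obtain H where H: "continuous_on UNIV H" "\<And>p. p \<in> A \<inter> B \<Longrightarrow> H p = h p"
    using Tietze_unbounded by blast
  \<comment> \<open>Degree 1 on the first circle, degree 0 on the second.\<close>
  define f where "f p = (if p \<in> A then snd p else exp (H p))" for p
  have f_B: "f p = exp (H p)" if "p \<in> B" for p
    using that h H by (auto simp: f_def)
  have "continuous_on (A \<union> B) f"
    unfolding f_def
    by (rule continuous_on_cases)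
       (use assms h H in \<open>auto intro!: continuous_intros continuous_on_subset[OF H(1)]\<close>)
  then have "continuous_on (UNIV \<times> ?S) f" by (simp add: cover)
  then have "continuous_on ({0..1} \<times> ?S) (\<lambda>p. f ((1 - fst p) *\<^sub>R a + fst p *\<^sub>R b, snd p))"
    by (rule continuous_on_compose2) (auto intro!: continuous_intros)
  moreover have "f p \<noteq> 0" if "p \<in> UNIV \<times> ?S" for p
    using that by (auto simp: f_def)
  ultimately have "homotopic_with_canon (\<lambda>_. True) ?S (-{0}) (\<lambda>w. f (a, w)) (\<lambda>w. f (b, w))"
    using homotopic_with_canonI[where h="\<lambda>p. f ((1 - fst p) *\<^sub>R a + fst p *\<^sub>R b, snd p)" and S="?S" and T="-{0}"]
    by auto
  moreover have "continuous_on ?S (\<lambda>w. H (b, w))"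
    by (rule continuous_on_compose2[OF H(1)]) (auto intro!: continuous_intros)
  then obtain c where "homotopic_with_canon (\<lambda>_. True) ?S (-{0}) (\<lambda>w. f (b, w)) (\<lambda>w. c)"
    using inessential_eq_continuous_logarithm[of ?S "\<lambda>w. f (b, w)"] f_B b by blast
  ultimately have "homotopic_with_canon (\<lambda>_. True) ?S (-{0}) (\<lambda>w. f (a, w)) (\<lambda>w. c)"
    by (rule homotopic_with_trans)
  then have "homotopic_with_canon (\<lambda>_. True) ?S (-{0}) (\<lambda>w. w) (\<lambda>w. c)"
    by (rule homotopic_with_eq) (use a in \<open>force simp: f_def\<close>)+
  with circle_identity_essential show False by blast
qed

section \<open>Continuity of smooth maps\<close>

text \<open>
  The common topological part of the charts of an abstract smooth manifold, of a
  submanifold of Euclidean space, and of an orbit space of the 3-sphere: what makes smooth maps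
  between them continuous.
\<close>

definition topological_charts :: "'a manifold3 \<Rightarrow> bool" where
  "topological_charts X \<longleftrightarrow>
     (\<forall>(U, \<phi>)\<in>charts X. openin (mtop X) U \<and>
        homeomorphic_map (subtopology (mtop X) U) (top_of_set (\<phi> ` U)) \<phi>)"

lemma smooth_manifold3_topological_charts:
  "smooth_manifold3 X \<Longrightarrow> topological_charts X"
  by (auto simp: smooth_manifold3_def topological_charts_def split: prod.splits)

lemma smooth_on_subset_imp_continuous_on:
  assumes "smooth_on_subset S f"
  shows "continuous_on S f"
  unfolding continuous_on_eq_continuous_within
proof
  fix x assume "x \<in> S"
  then obtain U F where U: "x \<in> U" "open U" "ck_on 0 F U" and F: "\<And>y. y \<in> S \<inter> U \<Longrightarrow> F y = f y"
    using assms unfolding smooth_on_subset_def smooth_on_open_def by meson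
  have "continuous_on (S \<inter> U) F"
    using U(3) by (auto intro: continuous_on_subset)
  then have "continuous_on (S \<inter> U) f"
    by (rule continuous_on_eq) (rule F)
  then have "continuous (at x within S \<inter> U) f"
    using \<open>x \<in> S\<close> U(1) by (auto simp: continuous_on_eq_continuous_within)
  moreover have "at x within S \<inter> U = at x within S"
    using U by (intro at_within_nhd[of x U]) auto
  ultimately show "continuous (at x within S) f" by simp
qed

lemma submanifold3_topological_charts: "topological_charts (submanifold3 S)"
  unfolding topological_charts_def
proof (clarify)
  fix U and \<phi> :: "'a \<Rightarrow> real^3"
  assume "(U, \<phi>) \<in> charts (submanifold3 S)"
  then have U: "openin (top_of_set S) U" and inj: "inj_on \<phi> U"
    and smooth: "smooth_on_subset U \<phi>" "smooth_on_subset (\<phi> ` U) (inv_into U \<phi>)"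
    by (auto simp: submanifold3_def)
  have "homeomorphic_maps (top_of_set U) (top_of_set (\<phi> ` U)) \<phi> (inv_into U \<phi>)"
    unfolding homeomorphic_maps_def
    using smooth_on_subset_imp_continuous_on[OF smooth(1)]
      smooth_on_subset_imp_continuous_on[OF smooth(2)] inj
    by (auto simp: continuous_map_in_subtopology f_inv_into_f inv_into_into)
  moreover have "subtopology (top_of_set S) U = top_of_set U"
    using openin_imp_subset[OF U] by (simp add: subtopology_subtopology Int_absorb1)
  ultimately show "openin (mtop (submanifold3 S)) U \<and>
      homeomorphic_map (subtopology (mtop (submanifold3 S)) U) (top_of_set (\<phi> ` U)) \<phi>"
    using U by (auto simp: submanifold3_def homeomorphic_map_maps)
qed

lemma chart_vimage_openin:
  assumes "topological_charts X" "(U, \<phi>) \<in> charts X" "open O'"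
  shows "openin (mtop X) {x \<in> U. \<phi> x \<in> O'}"
proof -
  have U: "openin (mtop X) U" and hom: "homeomorphic_map (subtopology (mtop X) U) (top_of_set (\<phi> ` U)) \<phi>"
    using assms by (auto simp: topological_charts_def)
  have sub: "U \<subseteq> mspace X" using U by (rule openin_subset)
  have "continuous_map (subtopology (mtop X) U) euclidean \<phi>"
    using homeomorphic_imp_continuous_map[OF hom] by (rule continuous_map_into_fulltopology)
  then have "openin (subtopology (mtop X) U) {x \<in> topspace (subtopology (mtop X) U). \<phi> x \<in> O'}"
    using \<open>open O'\<close> by (intro openin_continuous_map_preimage) auto
  moreover have "topspace (subtopology (mtop X) U) = U"
    using sub by (rule topspace_subtopology_subset)
  ultimately have "openin (subtopology (mtop X) U) {x \<in> U. \<phi> x \<in> O'}" by (simp del: topspace_subtopology)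
  then show ?thesis using U by (rule openin_trans_full)
qed

lemma chart_image_openin:
  assumes "topological_charts X" "(U, \<phi>) \<in> charts X" "openin (mtop X) V"
  shows "openin (top_of_set (\<phi> ` U)) (\<phi> ` (U \<inter> V))"
proof -
  have U: "openin (mtop X) U" and hom: "homeomorphic_map (subtopology (mtop X) U) (top_of_set (\<phi> ` U)) \<phi>"
    using assms by (auto simp: topological_charts_def)
  have "openin (subtopology (mtop X) U) (U \<inter> V)"
    using assms(3) by (metis openin_subtopology_Int2)
  then show ?thesis
    using homeomorphic_imp_open_map[OF hom] by (auto simp: open_map_def)
qed

lemma chart_inj_on:
  assumes "topological_charts X" "(U, \<phi>) \<in> charts X"
  shows "inj_on \<phi> U"
proof -
  have "openin (mtop X) U" and hom: "homeomorphic_map (subtopology (mtop X) U) (top_of_set (\<phi> ` U)) \<phi>"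
    using assms by (auto simp: topological_charts_def)
  then have "topspace (subtopology (mtop X) U) = U"
    by (intro topspace_subtopology_subset openin_subset)
  then show ?thesis
    using homeomorphic_imp_injective_map[OF hom] by simp
qed

lemma smooth_map_onE:
  assumes "smooth_map_on X Y S f" "p \<in> S"
  obtains U \<phi> V \<psi> W F where "(U, \<phi>) \<in> charts X" "(V, \<psi>) \<in> charts Y" "p \<in> U" "\<phi> p \<in> W"
    "smooth_on_open W F" "\<And>x. x \<in> S \<inter> U \<Longrightarrow> \<phi> x \<in> W \<Longrightarrow> f x \<in> V \<and> \<psi> (f x) = F (\<phi> x)"
proof -
  from assms have "\<exists>a\<in>charts X. \<exists>b\<in>charts Y. \<exists>W F. p \<in> fst a \<and> snd a p \<in> W \<and> smooth_on_open W F \<and>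
      (\<forall>x\<in>S \<inter> fst a. snd a x \<in> W \<longrightarrow> f x \<in> fst b \<and> snd b (f x) = F (snd a x))"
    unfolding smooth_map_on_def case_prod_beta by (elim conjE) (rule bspec)
  then obtain a b W F where "a \<in> charts X" "b \<in> charts Y" "p \<in> fst a" "snd a p \<in> W"
    "smooth_on_open W F"
    "\<forall>x\<in>S \<inter> fst a. snd a x \<in> W \<longrightarrow> f x \<in> fst b \<and> snd b (f x) = F (snd a x)"
    by (elim bexE exE conjE)
  then show thesis
    by (intro that[of "fst a" "snd a" "fst b" "snd b" W F]) simp_all
qed

lemma smooth_map_on_imp_continuous_map:
  assumes X: "topological_charts X" and Y: "topological_charts Y" and f: "smooth_map_on X Y S f"
  shows "continuous_map (subtopology (mtop X) S) (mtop Y) f"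
proof -
  have SX: "S \<subseteq> mspace X" and SY: "f ` S \<subseteq> mspace Y" using f by (auto simp: smooth_map_on_def)
  have nbhd: "\<exists>N. openin (subtopology (mtop X) S) N \<and> p \<in> N \<and> (\<forall>x\<in>N. f x \<in> O')"
    if "p \<in> S" and O': "openin (mtop Y) O'" "f p \<in> O'" for p O'
  proof -
    obtain U \<phi> V \<psi> W F where
      U: "(U, \<phi>) \<in> charts X" and V: "(V, \<psi>) \<in> charts Y" and "p \<in> U" "\<phi> p \<in> W"
      and W: "smooth_on_open W F"
      and F: "\<And>x. x \<in> S \<inter> U \<Longrightarrow> \<phi> x \<in> W \<Longrightarrow> f x \<in> V \<and> \<psi> (f x) = F (\<phi> x)"
      by (rule smooth_map_onE[OF f \<open>p \<in> S\<close>]) blast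
    obtain O2 where "open O2" and O2: "\<psi> ` (V \<inter> O') = \<psi> ` V \<inter> O2"
      using chart_image_openin[OF Y V O'(1)] by (auto simp: openin_open)
    have "continuous_on W F" "open W"
      using W unfolding smooth_on_open_def by (metis ck_on.simps(1))+
    then have "open (F -` O2 \<inter> W)"
      using \<open>open O2\<close> by (simp add: continuous_on_open_vimage)
    then have "openin (mtop X) {x \<in> U. \<phi> x \<in> F -` O2 \<inter> W}"
      by (rule chart_vimage_openin[OF X U])
    then have "openin (subtopology (mtop X) S) (S \<inter> {x \<in> U. \<phi> x \<in> F -` O2 \<inter> W})" (is "openin _ ?N")
      by (rule openin_subtopology_Int2)
    moreover have "p \<in> ?N"
    proof -
      have fp: "f p \<in> V" "\<psi> (f p) = F (\<phi> p)" using F \<open>p \<in> S\<close> \<open>p \<in> U\<close> \<open>\<phi> p \<in> W\<close> by blast+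
      then have "\<psi> (f p) \<in> \<psi> ` (V \<inter> O')" using O'(2) by blast
      then show ?thesis using fp O2 \<open>p \<in> S\<close> \<open>p \<in> U\<close> \<open>\<phi> p \<in> W\<close> by simp
    qed
    moreover have "f x \<in> O'" if "x \<in> ?N" for x
    proof -
      have x: "f x \<in> V" "\<psi> (f x) = F (\<phi> x)" using that F by blast+
      moreover have "F (\<phi> x) \<in> O2" using that by blast
      ultimately have "\<psi> (f x) \<in> \<psi> ` (V \<inter> O')" unfolding O2 by (metis IntI imageI)
      then obtain y where y: "y \<in> V" "y \<in> O'" "\<psi> (f x) = \<psi> y" by blast
      have "f x = y" by (rule inj_onD[OF chart_inj_on[OF Y V]]) (use x y in auto)
      with y(2) show ?thesis by simp
    qed
    ultimately show ?thesis
      by (intro exI[of _ ?N] conjI ballI)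
  qed
  have "topcontinuous_at (subtopology (mtop X) S) (mtop Y) f p" if "p \<in> S" for p
    unfolding topcontinuous_at_def using that SX SY nbhd[OF that] by auto
  then show ?thesis
    using SX by (simp add: continuous_map_eq_topcontinuous_at)
qed

lemma diffeomorphic_imp_homeomorphic_space:
  assumes "topological_charts X" "topological_charts Y" "diffeomorphic X Y"
  shows "mtop X homeomorphic_space mtop Y"
proof -
  obtain f where f: "bij_betw f (mspace X) (mspace Y)" "smooth_map_on X Y (mspace X) f"
    "smooth_map_on Y X (mspace Y) (inv_into (mspace X) f)"
    using assms(3) by (auto simp: diffeomorphic_def diffeomorphism_on_def)
  have "homeomorphic_maps (mtop X) (mtop Y) f (inv_into (mspace X) f)"
    unfolding homeomorphic_maps_def
  proof (intro conjI ballI)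
    show "continuous_map (mtop X) (mtop Y) f"
      using smooth_map_on_imp_continuous_map[OF assms(1,2) f(2)] by simp
    show "continuous_map (mtop Y) (mtop X) (inv_into (mspace X) f)"
      using smooth_map_on_imp_continuous_map[OF assms(2,1) f(3)] by simp
  qed (rule bij_betw_inv_into_left[OF f(1)] bij_betw_inv_into_right[OF f(1)]; assumption)+
  then show ?thesis by (auto simp: homeomorphic_space_def)
qed

section \<open>Compactness of the summands\<close>

lemma quotient_map_quotient_topology: "quotient_map X (quotient_topology X q) q"
proof -
  have "topspace (quotient_topology X q) = q ` topspace X"
  proof
    show "topspace (quotient_topology X q) \<subseteq> q ` topspace X"
      using openin_topspace[of "quotient_topology X q"] unfolding openin_quotient_topology by (rule conjunct1)
    have "{x \<in> topspace X. q x \<in> q ` topspace X} = topspace X" by auto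
    then have "openin (quotient_topology X q) (q ` topspace X)"
      by (simp add: openin_quotient_topology)
    then show "q ` topspace X \<subseteq> topspace (quotient_topology X q)"
      by (rule openin_subset)
  qed
  then show ?thesis by (simp add: quotient_map_def openin_quotient_topology)
qed

lemma orbit_eq_iff:
  assumes "subgroup_of_O4 \<Gamma>"
  shows "orbit \<Gamma> x = orbit \<Gamma> y \<longleftrightarrow> (\<exists>A\<in>\<Gamma>. A *v x = y)"
proof
  assume "orbit \<Gamma> x = orbit \<Gamma> y"
  moreover have "mat 1 *v y \<in> orbit \<Gamma> y"
    using assms unfolding orbit_def subgroup_of_O4_def by blast
  ultimately have "y \<in> orbit \<Gamma> x" by simp
  then show "\<exists>A\<in>\<Gamma>. A *v x = y" unfolding orbit_def by blast
next
  have sub: "orbit \<Gamma> (A *v z) \<subseteq> orbit \<Gamma> z" if "A \<in> \<Gamma>" for A z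
  proof
    fix w assume "w \<in> orbit \<Gamma> (A *v z)"
    then obtain B where "B \<in> \<Gamma>" "w = (B ** A) *v z"
      by (auto simp: orbit_def matrix_vector_mul_assoc)
    then show "w \<in> orbit \<Gamma> z"
      using assms that unfolding orbit_def subgroup_of_O4_def by blast
  qed
  assume "\<exists>A\<in>\<Gamma>. A *v x = y"
  then obtain A where A: "A \<in> \<Gamma>" "A *v x = y" by blast
  have "invertible A"
    using assms A(1) by (auto simp: subgroup_of_O4_def orthogonal_matrix_def invertible_def)
  then have "matrix_inv A ** A = mat 1"
    unfolding invertible_def matrix_inv_def by (rule someI2_ex) simp
  then have "matrix_inv A *v y = x"
    using A(2) by (metis matrix_vector_mul_assoc matrix_vector_mul_lid)
  moreover have "matrix_inv A \<in> \<Gamma>"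
    using assms A(1) by (simp add: subgroup_of_O4_def)
  ultimately show "orbit \<Gamma> x = orbit \<Gamma> y"
    using sub[of A x] sub[of "matrix_inv A" y] A by simp
qed

text \<open>
  The saturation of an open set is a union of its translates under the group, which are open.
\<close>

lemma open_map_orbit:
  assumes \<Gamma>: "subgroup_of_O4 \<Gamma>"
  shows "open_map (top_of_set (sphere 0 1)) (quotient_topology (top_of_set (sphere 0 1)) (orbit \<Gamma>)) (orbit \<Gamma>)"
  unfolding open_map_def
proof (intro allI impI)
  let ?S = "sphere (0::real^4) 1"
  fix U assume U: "openin (top_of_set ?S) U"
  have "openin (top_of_set ?S) (?S \<inter> (*v) A -` U)" if "A \<in> \<Gamma>" for A
  proof (rule continuous_openin_preimage[OF _ _ U])
    have "orthogonal_matrix A" using \<Gamma> that by (auto simp: subgroup_of_O4_def)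
    then have "orthogonal_transformation ((*v) A)"
      by (simp add: orthogonal_transformation_matrix)
    then show "(*v) A \<in> ?S \<rightarrow> ?S"
      by (auto simp: orthogonal_transformation_norm)
  qed (auto intro!: continuous_intros matrix_vector_mult_linear_continuous_on)
  then have "openin (top_of_set ?S) (\<Union>A\<in>\<Gamma>. ?S \<inter> (*v) A -` U)" by blast
  moreover have "(\<Union>A\<in>\<Gamma>. ?S \<inter> (*v) A -` U) = {x \<in> ?S. orbit \<Gamma> x \<in> orbit \<Gamma> ` U}"
    using orbit_eq_iff[OF \<Gamma>] by (auto simp: image_iff)
  ultimately show "openin (quotient_topology (top_of_set ?S) (orbit \<Gamma>)) (orbit \<Gamma> ` U)"
    using openin_imp_subset[OF U] by (auto simp: openin_quotient_topology)
qed

text \<open>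
  On a domain where the projection is injective, it is a homeomorphism onto an open set because
  it is open, so charts of the sphere push forward to charts of the orbit space.
\<close>

lemma S3_mod_topological_charts:
  assumes \<Gamma>: "subgroup_of_O4 \<Gamma>"
  shows "topological_charts (S3_mod \<Gamma>)"
  unfolding topological_charts_def
proof clarify
  let ?S = "top_of_set (sphere (0::real^4) 1)"
  let ?Q = "quotient_topology ?S (orbit \<Gamma>)"
  fix V \<theta> assume "(V, \<theta>) \<in> charts (S3_mod \<Gamma>)"
  then obtain U \<phi> where V: "V = orbit \<Gamma> ` U" "\<theta> = \<phi> \<circ> inv_into U (orbit \<Gamma>)"
    and \<phi>: "(U, \<phi>) \<in> charts (submanifold3 (sphere 0 1))" and inj: "inj_on (orbit \<Gamma>) U"
    by (auto simp: S3_mod_def)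
  have q: "continuous_map ?S ?Q (orbit \<Gamma>)"
    by (intro quotient_imp_continuous_map quotient_map_quotient_topology)
  have U: "openin ?S U" and hom: "homeomorphic_map (subtopology ?S U) (top_of_set (\<phi> ` U)) \<phi>"
    using submanifold3_topological_charts \<phi>
    unfolding topological_charts_def submanifold3_def by auto
  have V_open: "openin ?Q V"
    using open_map_orbit[OF \<Gamma>] U V by (auto simp: open_map_def)
  have "homeomorphic_map (subtopology ?S U) (subtopology ?Q V) (orbit \<Gamma>)"
  proof (rule bijective_open_imp_homeomorphic_map)
    show "continuous_map (subtopology ?S U) (subtopology ?Q V) (orbit \<Gamma>)"
      using q V by (auto simp: continuous_map_in_subtopology continuous_map_from_subtopology)
    show "open_map (subtopology ?S U) (subtopology ?Q V) (orbit \<Gamma>)"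
      using open_map_from_subtopology[OF open_map_orbit[OF \<Gamma>] U] V
      by (intro open_map_into_subtopology) auto
    show "orbit \<Gamma> ` topspace (subtopology ?S U) = topspace (subtopology ?Q V)"
      unfolding topspace_subtopology_subset[OF openin_subset[OF U]]
        topspace_subtopology_subset[OF openin_subset[OF V_open]] by (simp add: V)
    show "inj_on (orbit \<Gamma>) (topspace (subtopology ?S U))"
      unfolding topspace_subtopology_subset[OF openin_subset[OF U]] by (rule inj)
  qed
  then obtain \<sigma> where \<sigma>: "homeomorphic_maps (subtopology ?S U) (subtopology ?Q V) (orbit \<Gamma>) \<sigma>"
    unfolding homeomorphic_map_maps by blast
  have \<sigma>_inv: "\<sigma> y \<in> U \<and> orbit \<Gamma> (\<sigma> y) = y" if "y \<in> V" for y
    using \<sigma> that unfolding homeomorphic_maps_def continuous_map_def Pi_iff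
      topspace_subtopology_subset[OF openin_subset[OF U]]
      topspace_subtopology_subset[OF openin_subset[OF V_open]] by blast
  have "homeomorphic_map (subtopology ?Q V) (subtopology ?S U) \<sigma>"
    using \<sigma> by (simp add: homeomorphic_maps_map)
  then have "homeomorphic_map (subtopology ?Q V) (top_of_set (\<phi> ` U)) (\<phi> \<circ> \<sigma>)"
    using hom by (rule homeomorphic_map_compose)
  then have "homeomorphic_map (subtopology ?Q V) (top_of_set (\<phi> ` U)) \<theta>"
  proof (rule homeomorphic_map_eq)
    fix y assume "y \<in> topspace (subtopology ?Q V)"
    then have "y \<in> V" by simp
    then have "inv_into U (orbit \<Gamma>) y = \<sigma> y"
      using \<sigma>_inv by (intro inv_into_f_eq[OF inj]) auto
    then show "(\<phi> \<circ> \<sigma>) y = \<theta> y" by (simp add: V(2))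
  qed
  moreover have "\<theta> ` V = \<phi> ` U"
    using inj V by (auto simp: image_iff)
  ultimately show "openin (mtop (S3_mod \<Gamma>)) V \<and>
      homeomorphic_map (subtopology (mtop (S3_mod \<Gamma>)) V) (top_of_set (\<theta> ` V)) \<theta>"
    using V_open by (simp add: S3_mod_def)
qed

lemma compact_space_S3_mod: "compact_space (mtop (S3_mod \<Gamma>))"
proof -
  let ?S = "top_of_set (sphere (0::real^4) 1)"
  have q: "quotient_map ?S (mtop (S3_mod \<Gamma>)) (orbit \<Gamma>)"
    by (simp add: S3_mod_def quotient_map_quotient_topology)
  have "compactin ?S (topspace ?S)"
    by (simp add: compactin_subtopology)
  then have "compactin (mtop (S3_mod \<Gamma>)) (orbit \<Gamma> ` topspace ?S)"
    using q by (intro image_compactin quotient_imp_continuous_map)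
  then show ?thesis
    using quotient_imp_surjective_map[OF q] by (simp add: compact_space_def)
qed

lemma compact_space_summand:
  assumes "spherical_manifold X \<or> S2_times_S1_manifold X"
  shows "compact_space (mtop X)"
  using assms
proof
  assume "spherical_manifold X"
  then obtain \<Gamma> where "smooth_manifold3 X" "subgroup_of_O4 \<Gamma>" "diffeomorphic X (S3_mod \<Gamma>)"
    by (auto simp: spherical_manifold_def)
  then show ?thesis
    using diffeomorphic_imp_homeomorphic_space smooth_manifold3_topological_charts
      S3_mod_topological_charts homeomorphic_compact_space compact_space_S3_mod by blast
next
  assume "S2_times_S1_manifold X"
  then have "smooth_manifold3 X" "diffeomorphic X S2_times_S1"
    by (auto simp: S2_times_S1_manifold_def)
  moreover have "compact_space (mtop S2_times_S1)"
    by (simp add: S2_times_S1_def submanifold3_def compact_space_subtopology compact_Times)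
  ultimately show ?thesis
    using diffeomorphic_imp_homeomorphic_space smooth_manifold3_topological_charts
      submanifold3_topological_charts homeomorphic_compact_space unfolding S2_times_S1_def by blast
qed

section \<open>Embedded closed balls\<close>

lemma smooth_manifold3_chartE:
  fixes X :: "'m manifold3"
  assumes X: "smooth_manifold3 X" and p: "p \<in> mspace X"
  obtains U and \<phi> :: "'m \<Rightarrow> real^3" and \<sigma> where "p \<in> U" "openin (mtop X) U" "open (\<phi> ` U)"
    "continuous_map (subtopology (mtop X) U) euclidean \<phi>"
    "continuous_map (top_of_set (\<phi> ` U)) (mtop X) \<sigma>" "\<forall>x\<in>U. \<sigma> (\<phi> x) = x"
proof -
  obtain a where a: "a \<in> charts X" "p \<in> fst a"
    using X p unfolding smooth_manifold3_def case_prod_beta by blast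
  define U \<phi> where "U = fst a" and "\<phi> = snd a"
  have U: "openin (mtop X) U" "open (\<phi> ` U)"
    and hom: "homeomorphic_map (subtopology (mtop X) U) (top_of_set (\<phi> ` U)) \<phi>"
    using X a(1) unfolding smooth_manifold3_def case_prod_beta U_def \<phi>_def by blast+
  from hom obtain \<sigma> where \<sigma>: "homeomorphic_maps (subtopology (mtop X) U) (top_of_set (\<phi> ` U)) \<phi> \<sigma>"
    unfolding homeomorphic_map_maps by blast
  show thesis
  proof (rule that[of U \<phi> \<sigma>])
    show "continuous_map (subtopology (mtop X) U) euclidean \<phi>"
      using \<sigma> unfolding homeomorphic_maps_def by (blast intro: continuous_map_into_fulltopology)
    show "continuous_map (top_of_set (\<phi> ` U)) (mtop X) \<sigma>"
      using \<sigma> unfolding homeomorphic_maps_def by (blast intro: continuous_map_into_fulltopology)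
    show "\<forall>x\<in>U. \<sigma> (\<phi> x) = x"
      using \<sigma> unfolding homeomorphic_maps_def topspace_subtopology_subset[OF openin_subset[OF U(1)]]
      by blast
    show "p \<in> U" using a(2) by (simp add: U_def)
  qed (rule U)+
qed

lemma closed_3ballE:
  assumes X: "smooth_manifold3 X" and "closed_3ball X B"
  obtains f where "continuous_map (top_of_set (cball 0 1)) (mtop X) f" "inj_on f (cball (0::real^3) 1)"
    "f ` cball 0 1 = B" "continuous_map (subtopology (mtop X) B) euclidean (inv_into (cball 0 1) f)"
proof -
  let ?E = "submanifold3 (UNIV :: (real^3) set)"
  obtain f where f: "bij_betw f (cball 0 1) B" "smooth_map_on ?E X (cball 0 1) f"
      "smooth_map_on X ?E B (inv_into (cball 0 1) f)"
    using assms(2) unfolding closed_3ball_def diffeomorphism_on_def by blast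
  have E: "mtop ?E = euclidean" by (simp add: submanifold3_def)
  note charts = submanifold3_topological_charts[of UNIV] smooth_manifold3_topological_charts[OF X]
  show thesis
  proof (rule that[of f])
    show "continuous_map (top_of_set (cball 0 1)) (mtop X) f"
      using smooth_map_on_imp_continuous_map[OF charts f(2)] unfolding E .
    show "continuous_map (subtopology (mtop X) B) euclidean (inv_into (cball 0 1) f)"
      using smooth_map_on_imp_continuous_map[OF charts(2,1) f(3)] unfolding E .
    show "inj_on f (cball 0 1)" "f ` cball 0 1 = B"
      using f(1) by (auto simp: bij_betw_def)
  qed
qed

text \<open>
  In a chart around \<open>f x\<close>, the map \<open>f\<close> is a continuous injection from an open subset of \<open>real^3\<close> to
  \<open>real^3\<close>. By invariance of domain its image is open.
\<close>

lemma open_ball_subset_interior: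
  fixes f :: "real^3 \<Rightarrow> 'm"
  assumes X: "smooth_manifold3 X"
    and f: "continuous_map (top_of_set (cball 0 1)) (mtop X) f" "inj_on f (cball 0 1)"
    and x: "x \<in> ball 0 1"
  shows "f x \<in> mtop X interior_of (f ` cball 0 1)"
proof -
  have "x \<in> cball 0 1" using x by simp
  then have "f x \<in> mspace X" using continuous_map_image_subset_topspace[OF f(1)] by auto
  then obtain U and \<phi> :: "'m \<Rightarrow> real^3" and \<sigma> where U: "f x \<in> U" "openin (mtop X) U" and "open (\<phi> ` U)"
    and \<phi>: "continuous_map (subtopology (mtop X) U) euclidean \<phi>"
    and "continuous_map (top_of_set (\<phi> ` U)) (mtop X) \<sigma>" and \<sigma>_\<phi>: "\<forall>y\<in>U. \<sigma> (\<phi> y) = y"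
    by (rule smooth_manifold3_chartE[OF X])
  note \<sigma> = bspec[OF \<sigma>_\<phi>]
  define N where "N = {y \<in> ball 0 1. f y \<in> U}"
  have "openin (top_of_set (cball 0 1)) {y \<in> topspace (top_of_set (cball 0 1)). f y \<in> U}"
    using f(1) U(2) by (rule openin_continuous_map_preimage)
  then obtain T where "open T" and T: "{y \<in> topspace (top_of_set (cball 0 1)). f y \<in> U} = cball 0 1 \<inter> T"
    unfolding openin_open by blast
  have "N = ball 0 1 \<inter> {y \<in> topspace (top_of_set (cball 0 1)). f y \<in> U}"
    unfolding N_def by auto
  also have "\<dots> = ball 0 1 \<inter> T"
    unfolding T using ball_subset_cball by blast
  finally have "N = ball 0 1 \<inter> T" .
  then have "open N" using \<open>open T\<close> by (simp add: open_Int)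
  have sub: "N \<subseteq> cball 0 1" unfolding N_def by auto
  have "continuous_map (top_of_set N) (mtop X) f"
    using continuous_map_from_subtopology_mono[OF f(1) sub] .
  then have "continuous_map (top_of_set N) (subtopology (mtop X) U) f"
    by (rule continuous_map_into_subtopology) (auto simp: N_def)
  then have "continuous_map (top_of_set N) euclidean (\<phi> \<circ> f)"
    using \<phi> by (rule continuous_map_compose)
  then have "continuous_on N (\<phi> \<circ> f)" by simp
  moreover have "inj_on (\<phi> \<circ> f) N"
  proof (rule inj_onI)
    fix y z assume yz: "y \<in> N" "z \<in> N" "(\<phi> \<circ> f) y = (\<phi> \<circ> f) z"
    then have "f y \<in> U" "f z \<in> U" unfolding N_def by blast+
    moreover have "\<phi> (f y) = \<phi> (f z)" using yz(3) by (simp only: comp_apply)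
    ultimately have "f y = f z" using \<sigma> by metis
    then show "y = z" using inj_onD[OF f(2)] yz(1,2) sub by blast
  qed
  ultimately have O': "open ((\<phi> \<circ> f) ` N)" (is "open ?O")
    using \<open>open N\<close> by (intro invariance_of_domain)
  have "f ` N = {y \<in> topspace (subtopology (mtop X) U). \<phi> y \<in> ?O}"
  proof (intro set_eqI iffI)
    fix y assume "y \<in> f ` N"
    then show "y \<in> {y \<in> topspace (subtopology (mtop X) U). \<phi> y \<in> ?O}"
      using openin_subset[OF U(2)] unfolding N_def topspace_subtopology comp_def by blast
  next
    fix y assume "y \<in> {y \<in> topspace (subtopology (mtop X) U). \<phi> y \<in> ?O}"
    then obtain z where z: "y \<in> U" "z \<in> N" "\<phi> y = \<phi> (f z)"
      unfolding topspace_subtopology comp_def by blast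
    then have "f z \<in> U" unfolding N_def by blast
    then have "y = f z" using \<sigma> z by metis
    with z(2) show "y \<in> f ` N" by blast
  qed
  moreover have "openin (subtopology (mtop X) U) {y \<in> topspace (subtopology (mtop X) U). \<phi> y \<in> ?O}"
    using \<phi> O' by (intro openin_continuous_map_preimage) auto
  ultimately have "openin (mtop X) (f ` N)" using openin_trans_full U(2) by metis
  moreover have "f ` N \<subseteq> f ` cball 0 1" using sub by blast
  moreover have "f x \<in> f ` N" using x U(1) by (auto simp: N_def)
  ultimately show ?thesis unfolding interior_of_def by blast
qed

text \<open>
  Dually, an interior point of the embedded ball has a chart neighbourhood inside the ball, and the
  inverse embedding, read in this chart, is a continuous injection to \<open>real^3\<close>. By invariance of
  domain its image is an open subset of the closed unit ball, so it avoids the unit sphere.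
\<close>

lemma interior_subset_open_ball:
  fixes f :: "real^3 \<Rightarrow> 'm"
  assumes X: "smooth_manifold3 X" and inj: "inj_on f (cball 0 1)"
    and inv: "continuous_map (subtopology (mtop X) (f ` cball 0 1)) euclidean (inv_into (cball 0 1) f)"
    and x: "x \<in> cball 0 1" "f x \<in> mtop X interior_of (f ` cball 0 1)"
  shows "x \<in> ball 0 1"
proof -
  let ?I = "mtop X interior_of (f ` cball 0 1)" and ?r = "inv_into (cball 0 1) f"
  have I: "openin (mtop X) ?I" "?I \<subseteq> f ` cball 0 1"
    by (rule openin_interior_of, rule interior_of_subset)
  have "f x \<in> mspace X" using x(2) openin_subset[OF I(1)] by blast
  then obtain U and \<phi> :: "'m \<Rightarrow> real^3" and \<sigma> where U: "f x \<in> U" "openin (mtop X) U" "open (\<phi> ` U)"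
    and \<phi>: "continuous_map (subtopology (mtop X) U) euclidean \<phi>"
    and cont_\<sigma>: "continuous_map (top_of_set (\<phi> ` U)) (mtop X) \<sigma>" and \<sigma>_\<phi>: "\<forall>y\<in>U. \<sigma> (\<phi> y) = y"
    by (rule smooth_manifold3_chartE[OF X])
  note \<sigma> = cont_\<sigma> bspec[OF \<sigma>_\<phi>]
  define J where "J = \<phi> ` (U \<inter> ?I)"
  have "J = {z \<in> topspace (top_of_set (\<phi> ` U)). \<sigma> z \<in> ?I}"
    using \<sigma>(2) by (auto simp: J_def)
  then have "openin (top_of_set (\<phi> ` U)) J"
    using openin_continuous_map_preimage[OF \<sigma>(1) I(1)] by simp
  then have "open J" using U(3) by (rule openin_open_trans)
  have "continuous_map (top_of_set J) (mtop X) \<sigma>"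
    by (rule continuous_map_from_subtopology_mono[OF \<sigma>(1)]) (auto simp: J_def)
  then have "continuous_map (top_of_set J) (subtopology (mtop X) (f ` cball 0 1)) \<sigma>"
    by (rule continuous_map_into_subtopology) (use \<sigma>(2) I(2) in \<open>auto simp: J_def\<close>)
  then have "continuous_map (top_of_set J) euclidean (?r \<circ> \<sigma>)"
    using inv by (rule continuous_map_compose)
  then have cont: "continuous_on J (?r \<circ> \<sigma>)" by simp
  have f_r: "f ((?r \<circ> \<sigma>) z) = \<sigma> z \<and> (?r \<circ> \<sigma>) z \<in> cball 0 1" if "z \<in> J" for z
  proof -
    have "\<sigma> z \<in> f ` cball 0 1" using that \<sigma>(2) I(2) by (auto simp: J_def)
    then show ?thesis using f_inv_into_f inv_into_into by (metis comp_apply)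
  qed
  have "inj_on (?r \<circ> \<sigma>) J"
  proof (rule inj_onI)
    fix z w assume zw: "z \<in> J" "w \<in> J" "(?r \<circ> \<sigma>) z = (?r \<circ> \<sigma>) w"
    then have "\<sigma> z = \<sigma> w" using f_r by metis
    then show "z = w" using zw(1,2) \<sigma>(2) by (auto simp: J_def)
  qed
  then have "open ((?r \<circ> \<sigma>) ` J)"
    using cont \<open>open J\<close> by (intro invariance_of_domain)
  moreover have "(?r \<circ> \<sigma>) ` J \<subseteq> cball 0 1" using f_r by blast
  ultimately have "(?r \<circ> \<sigma>) ` J \<subseteq> interior (cball 0 1)" by (rule interior_maximal[rotated])
  moreover have "x \<in> (?r \<circ> \<sigma>) ` J"
  proof (rule image_eqI)
    show "\<phi> (f x) \<in> J" using U(1) x(2) by (simp add: J_def)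
    show "x = (?r \<circ> \<sigma>) (\<phi> (f x))" using \<sigma>(2)[OF U(1)] inj x(1) by (simp add: inv_into_f_f)
  qed
  ultimately show ?thesis by auto
qed

proposition closed_3ball_boundary:
  assumes X: "smooth_manifold3 X" and B: "closed_3ball X B"
  shows "closedin (mtop X) B"
    and "\<exists>f. continuous_map (top_of_set (sphere (0::real^3) 1)) (mtop X) f \<and> inj_on f (sphere 0 1) \<and>
             f ` sphere 0 1 = mtop X frontier_of B"
proof -
  obtain f :: "real^3 \<Rightarrow> _" where f: "continuous_map (top_of_set (cball 0 1)) (mtop X) f" "inj_on f (cball 0 1)"
    and im: "f ` cball 0 1 = B"
    and inv: "continuous_map (subtopology (mtop X) B) euclidean (inv_into (cball 0 1) f)"
    using closed_3ballE[OF X B] by blast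
  have "compactin (top_of_set (cball 0 1)) (cball (0::real^3) 1)"
    by (simp add: compactin_subtopology)
  then have "compactin (mtop X) B"
    using image_compactin f(1) im by metis
  then show closed: "closedin (mtop X) B"
    using X compactin_imp_closedin by (auto simp: smooth_manifold3_def)
  have "x \<in> ball 0 1 \<longleftrightarrow> f x \<in> mtop X interior_of B" if "x \<in> cball 0 1" for x
    using open_ball_subset_interior[OF X f] interior_subset_open_ball[OF X f(2)] inv that unfolding im by blast
  then have "f ` sphere 0 1 = B - mtop X interior_of B"
    unfolding im[symmetric] by (force simp: image_iff)
  also have "\<dots> = mtop X frontier_of B"
    by (simp add: frontier_of_def closure_of_closedin closed)
  finally have "f ` sphere 0 1 = mtop X frontier_of B" .
  moreover have "continuous_map (top_of_set (sphere 0 1)) (mtop X) f"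
    by (rule continuous_map_from_subtopology_mono[OF f(1)]) auto
  moreover have "inj_on f (sphere 0 1)"
    using f(2) by (rule inj_on_subset) auto
  ultimately show "\<exists>f. continuous_map (top_of_set (sphere (0::real^3) 1)) (mtop X) f \<and> inj_on f (sphere 0 1) \<and>
             f ` sphere 0 1 = mtop X frontier_of B" by blast
qed

section \<open>Connected sums of compact manifolds\<close>

text \<open>
  The setting of the separation argument, which applies to arbitrary compact summands.
\<close>

locale ball_gluing = bidirected_digraph G arev
  for G :: "('v, 'e) pre_digraph" and arev +
  fixes X :: "'v \<Rightarrow> 'm manifold3" and B :: "'e \<Rightarrow> 'm set" and g :: "'e \<Rightarrow> 'm \<Rightarrow> 'm"
  assumes finite_out_arcs: "v \<in> verts G \<Longrightarrow> finite (out_arcs G v)"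
    and summand_smooth: "v \<in> verts G \<Longrightarrow> smooth_manifold3 (X v)"
    and summand_compact: "v \<in> verts G \<Longrightarrow> compact_space (mtop (X v))"
    and balls: "disjoint_balls G X B"
    and gluing: "gluing_maps G arev X B g"
begin

abbreviation P where "P \<equiv> piece G X B"
abbreviation S where "S \<equiv> bsphere G X B"
abbreviation q where "q v x \<equiv> glue_class G X B g (v, x)"
abbreviation Q where "Q \<equiv> glued_space G X B g"

lemma closed_ball: "e \<in> arcs G \<Longrightarrow> closed_3ball (X (tail G e)) (B e)"
  using balls by (simp add: disjoint_balls_def)

lemma closedin_ball: "e \<in> arcs G \<Longrightarrow> closedin (mtop (X (tail G e))) (B e)"
  by (rule closed_3ball_boundary(1)[OF summand_smooth closed_ball]) simp_all

lemma sphere_subset_ball: "e \<in> arcs G \<Longrightarrow> S e \<subseteq> B e"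
  unfolding bsphere_def frontier_of_def using closure_of_closedin[OF closedin_ball] by blast

lemma balls_disjoint:
  assumes "e \<in> arcs G" "e' \<in> arcs G" "tail G e = tail G e'" "e \<noteq> e'"
  shows "B e \<inter> B e' = {}"
proof -
  have "disjoint_family_on B (out_arcs G (tail G e))"
    using balls assms(1) by (simp add: disjoint_balls_def)
  moreover have "e \<in> out_arcs G (tail G e)" "e' \<in> out_arcs G (tail G e)"
    using assms by simp_all
  ultimately show ?thesis using assms(4) unfolding disjoint_family_on_def by blast
qed

lemma sphere_unique:
  assumes "e \<in> arcs G" "e' \<in> arcs G" "tail G e = tail G e'" "x \<in> S e" "x \<in> S e'"
  shows "e = e'"
proof (rule ccontr)
  assume "e \<noteq> e'"
  then have "B e \<inter> B e' = {}" by (rule balls_disjoint[OF assms(1-3)])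
  then show False using sphere_subset_ball assms by blast
qed

lemma sphere_subset_piece:
  assumes e: "e \<in> arcs G"
  shows "S e \<subseteq> P (tail G e)"
proof
  fix x assume x: "x \<in> S e"
  have "x \<in> mspace (X (tail G e))"
    using x frontier_of_subset_topspace unfolding bsphere_def by fast
  moreover have "x \<notin> mtop (X (tail G e)) interior_of B e'" if e': "e' \<in> out_arcs G (tail G e)" for e'
  proof (cases "e' = e")
    case True
    then show ?thesis using x by (simp add: bsphere_def frontier_of_def)
  next
    case False
    then have "B e \<inter> B e' = {}"
      using balls_disjoint[OF e, of e'] e' by auto
    then show ?thesis
      using sphere_subset_ball[OF e] x interior_of_subset by fast
  qed
  ultimately show "x \<in> P (tail G e)" unfolding piece_def by blast
qed

lemma glue_maps_sphere:
  assumes "e \<in> arcs G" "x \<in> S e"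
  shows "g e x \<in> S (arev e)" "g (arev e) (g e x) = x"
  using gluing assms by (auto simp: gluing_maps_def diffeomorphism_on_def bij_betw_def)

lemma glue_class_refl: "p \<in> glue_class G X B g p"
  by (simp add: glue_class_def)

text \<open>
  Following the gluing map twice leads back, since distinct boundary spheres of a piece are disjoint:
  the only arc through \<open>(head G e, g e x)\<close> is \<open>arev e\<close>. Hence every class has at most two points.
\<close>

lemma glue_class_seam:
  assumes e: "e \<in> arcs G" and x: "x \<in> S e"
  shows "q (tail G e) x = {(tail G e, x), (head G e, g e x)}" (is "_ = ?T")
proof -
  let ?R = "{((tail G e, x), (head G e, g e x)) | e x. e \<in> arcs G \<and> x \<in> S e}"
  have "?R `` ?T \<subseteq> ?T"
  proof
    fix p assume "p \<in> ?R `` ?T"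
    then obtain r where r: "r \<in> ?T" "(r, p) \<in> ?R" by blast
    then obtain e' y where e': "e' \<in> arcs G" "y \<in> S e'" "r = (tail G e', y)" "p = (head G e', g e' y)"
      by blast
    have "(tail G e' = tail G e \<and> y = x) \<or> (tail G e' = head G e \<and> y = g e x)"
      using r(1) unfolding e'(3) by simp
    then consider "tail G e' = tail G e" "y = x" | "tail G e' = head G e" "y = g e x" by blast
    then show "p \<in> ?T"
    proof cases
      case 1
      then have "e' = e" using sphere_unique[OF e'(1) e] e'(2) x by simp
      then show ?thesis using e'(4) 1 by simp
    next
      case 2
      then have "e' = arev e"
        using sphere_unique[of e' "arev e" y] e' e glue_maps_sphere(1)[OF e x] by simp
      then show ?thesis using e'(4) 2 e glue_maps_sphere(2)[OF e x] by simp
    qed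
  qed
  then have "?R\<^sup>* `` ?T = ?T" by (rule Image_closed_trancl)
  then have "?R\<^sup>* `` {(tail G e, x)} \<subseteq> ?T" by blast
  moreover have "((tail G e, x), (head G e, g e x)) \<in> ?R" using e x by blast
  then have "?T \<subseteq> ?R\<^sup>* `` {(tail G e, x)}" by blast
  ultimately show ?thesis unfolding glue_class_def by (rule subset_antisym)
qed

lemma glue_class_inner:
  assumes "\<And>e. e \<in> out_arcs G v \<Longrightarrow> x \<notin> S e"
  shows "q v x = {(v, x)}"
proof -
  have "{((tail G e, x), (head G e, g e x)) | e x. e \<in> arcs G \<and> x \<in> S e}\<^sup>* `` {(v, x)} = {(v, x)}"
    by (rule Image_closed_trancl) (use assms in auto)
  then show ?thesis by (simp add: glue_class_def)
qed

lemma finite_glue_class: "finite (q v x)"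
proof (cases "\<exists>e\<in>out_arcs G v. x \<in> S e")
  case True
  then show ?thesis using glue_class_seam by fastforce
next
  case False
  then show ?thesis using glue_class_inner by simp
qed

lemma glue_class_across:
  assumes "e \<in> arcs G" "x \<in> S e"
  shows "q (head G e) (g e x) = q (tail G e) x"
  using glue_class_seam[OF assms] glue_class_seam[of "arev e" "g e x"] glue_maps_sphere[OF assms] assms
  by auto

definition part :: "'v set \<Rightarrow> ('v \<times> 'm) set set" where
  "part V = (\<Union>v\<in>V. q v ` P v)"

text \<open>
  Whether a point of a piece lies in the union of the pieces over \<open>V\<close> is visible in the piece
  itself. This computes the preimage of \<open>part V\<close> in each piece, and so decides closedness in
  the quotient topology.
\<close>

lemma mem_part_iff:
  assumes "x \<in> P v"
  shows "q v x \<in> part V \<longleftrightarrow> v \<in> V \<or> (\<exists>e\<in>out_arcs G v. head G e \<in> V \<and> x \<in> S e)"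
proof
  assume "q v x \<in> part V"
  then obtain w y where "w \<in> V" "q v x = q w y" by (auto simp: part_def)
  then have wy: "w \<in> V" "(w, y) \<in> q v x" using glue_class_refl by auto
  show "v \<in> V \<or> (\<exists>e\<in>out_arcs G v. head G e \<in> V \<and> x \<in> S e)"
  proof (cases "\<exists>e\<in>out_arcs G v. x \<in> S e")
    case True
    then obtain e where e: "e \<in> arcs G" "tail G e = v" "x \<in> S e" by auto
    then show ?thesis using wy glue_class_seam[OF e(1,3)] by auto
  next
    case False
    then show ?thesis using wy glue_class_inner by auto
  qed
next
  assume R: "v \<in> V \<or> (\<exists>e\<in>out_arcs G v. head G e \<in> V \<and> x \<in> S e)"
  show "q v x \<in> part V"
  proof (cases "v \<in> V")
    case True
    then show ?thesis using assms by (auto simp: part_def)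
  next
    case False
    with R obtain e where e: "e \<in> arcs G" "tail G e = v" "head G e \<in> V" "x \<in> S e" by auto
    then have "g e x \<in> P (head G e)"
      using sphere_subset_piece[of "arev e"] glue_maps_sphere(1)[OF e(1,4)] by auto
    then have "q (head G e) (g e x) \<in> part V" using e(3) by (auto simp: part_def)
    then show ?thesis using glue_class_across[OF e(1,4)] e(2) by simp
  qed
qed

lemma piece_subset: "P v \<subseteq> mspace (X v)"
  by (auto simp: piece_def)

lemma quotient_map_glue:
  "quotient_map (sum_topology (\<lambda>v. subtopology (mtop (X v)) (P v)) (verts G)) Q (glue_class G X B g)"
  unfolding glued_space_def by (rule quotient_map_quotient_topology)

lemma topspace_pieces:
  "topspace (sum_topology (\<lambda>v. subtopology (mtop (X v)) (P v)) (verts G)) = Sigma (verts G) P"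
  using piece_subset by (simp add: Int_absorb1 comp_def)

lemma topspace_glued: "topspace Q = part (verts G)"
proof -
  have "part (verts G) = glue_class G X B g ` Sigma (verts G) P"
    unfolding part_def by force
  then show ?thesis
    using quotient_imp_surjective_map[OF quotient_map_glue] unfolding topspace_pieces by simp
qed

lemma continuous_map_glue:
  assumes "v \<in> verts G"
  shows "continuous_map (subtopology (mtop (X v)) (P v)) Q (q v)"
  using continuous_map_compose[OF continuous_map_component_injection[OF assms]
      quotient_imp_continuous_map[OF quotient_map_glue]] by (simp add: comp_def)

text \<open>
  The preimage of \<open>part V\<close> in a piece is the whole piece or a union of boundary spheres. The union
  is finite because the graph is locally finite.
\<close>

lemma closedin_part:
  assumes V: "V \<subseteq> verts G"
  shows "closedin Q (part V)"
proof -
  have sub: "part V \<subseteq> topspace Q" using V by (auto simp: topspace_glued part_def)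
  have "closedin (subtopology (mtop (X v)) (P v)) {x \<in> P v. q v x \<in> part V}" if v: "v \<in> verts G" for v
  proof (cases "v \<in> V")
    case True
    then have "{x \<in> P v. q v x \<in> part V} = P v" using mem_part_iff by blast
    also have "\<dots> = topspace (subtopology (mtop (X v)) (P v))"
      using piece_subset by (simp add: Int_absorb1)
    finally show ?thesis by (metis closedin_topspace)
  next
    case False
    let ?E = "{e \<in> out_arcs G v. head G e \<in> V}"
    have eq: "{x \<in> P v. q v x \<in> part V} = (\<Union>e\<in>?E. S e)"
      using False mem_part_iff[where V=V] sphere_subset_piece by fastforce
    have "closedin (subtopology (mtop (X v)) (P v)) (S e)" if "e \<in> out_arcs G v" for e
      using that sphere_subset_piece[of e] closedin_frontier_of[of "mtop (X v)" "B e"]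
      by (intro closedin_subset_topspace) (auto simp: bsphere_def)
    moreover have "finite ?E" using finite_out_arcs[OF v] by (rule finite_subset[rotated]) blast
    ultimately show ?thesis
      unfolding eq by (intro closedin_Union finite_imageI) auto
  qed
  then have "closedin (sum_topology (\<lambda>v. subtopology (mtop (X v)) (P v)) (verts G))
      {p \<in> Sigma (verts G) P. glue_class G X B g p \<in> part V}"
    unfolding closedin_sum_topology using piece_subset by (simp add: subset_iff)
  then show ?thesis
    using conjunct2[OF quotient_map_glue[unfolded quotient_map_closedin topspace_pieces], rule_format, OF sub]
    by (rule iffD1[rotated])
qed

lemma compactin_part:
  assumes "finite V" "V \<subseteq> verts G"
  shows "compactin Q (part V)"
proof -
  have "compactin Q (q v ` P v)" if "v \<in> V" for v
  proof (rule image_compactin)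
    have v: "v \<in> verts G" using that assms by blast
    have "closedin (mtop (X v)) (P v)"
      unfolding piece_def by (intro closedin_diff closedin_topspace openin_Union) auto
    then show "compactin (subtopology (mtop (X v)) (P v)) (P v)"
      using summand_compact[OF v] closedin_compact_space by (auto simp: compactin_subtopology)
    show "continuous_map (subtopology (mtop (X v)) (P v)) Q (q v)"
      by (rule continuous_map_glue[OF v])
  qed
  then show ?thesis unfolding part_def using assms(1) by (intro compactin_Union) auto
qed

lemma part_Un_complement: "V \<subseteq> verts G \<Longrightarrow> part V \<union> part (verts G - V) = topspace Q"
  by (auto simp: topspace_glued part_def)

text \<open>
  The complement of \<open>part (verts G - V)\<close> is open and consists of the classes all of whose
  representatives lie over \<open>V\<close>. Since every class is finite, such complements with \<open>V\<close> finite cover the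
  glued space.
\<close>

lemma compactin_subset_part:
  assumes K: "compactin Q K"
  obtains V where "finite V" "V \<subseteq> verts G" "K \<subseteq> part V"
proof -
  define \<U> where "\<U> = (\<lambda>V. topspace Q - part (verts G - V)) ` {V. finite V \<and> V \<subseteq> verts G}"
  have "openin Q U" if "U \<in> \<U>" for U
    using that closedin_part by (auto simp: \<U>_def)
  moreover have "K \<subseteq> \<Union>\<U>"
  proof
    fix c assume "c \<in> K"
    then have c: "c \<in> topspace Q" using compactin_subset_topspace[OF K] by blast
    then obtain v x where vx: "v \<in> verts G" "x \<in> P v" "c = q v x"
      by (auto simp: topspace_glued part_def)
    define V where "V = fst ` c \<inter> verts G"
    have "finite V" using finite_glue_class by (simp add: V_def vx(3))
    moreover have "c \<notin> part (verts G - V)"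
    proof
      assume "c \<in> part (verts G - V)"
      then obtain w y where "w \<in> verts G - V" "c = q w y" by (auto simp: part_def)
      then show False using glue_class_refl[of "(w, y)"] by (force simp: V_def)
    qed
    ultimately show "c \<in> \<Union>\<U>" using c unfolding \<U>_def V_def by blast
  qed
  ultimately have "\<exists>\<F>. finite \<F> \<and> \<F> \<subseteq> \<U> \<and> K \<subseteq> \<Union>\<F>"
    using K unfolding compactin_def by simp
  then obtain \<F> where \<F>: "finite \<F>" "\<F> \<subseteq> \<U>" "K \<subseteq> \<Union>\<F>" by (elim exE conjE)
  have "\<exists>\<V>\<subseteq>{V. finite V \<and> V \<subseteq> verts G}. finite \<V> \<and>
      \<F> = (\<lambda>V. topspace Q - part (verts G - V)) ` \<V>"
    using \<F>(1,2) unfolding \<U>_def by (rule finite_subset_image)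
  then obtain \<V> where \<V>: "\<V> \<subseteq> {V. finite V \<and> V \<subseteq> verts G}" "finite \<V>"
      "\<F> = (\<lambda>V. topspace Q - part (verts G - V)) ` \<V>" by (elim exE conjE)
  show thesis
  proof (rule that[of "\<Union>\<V>"])
    show "K \<subseteq> part (\<Union>\<V>)"
    proof
      fix c assume "c \<in> K"
      then obtain V where V: "V \<in> \<V>" "c \<in> topspace Q - part (verts G - V)"
        using \<F>(3) \<V>(3) by blast
      then have "c \<in> part V" using part_Un_complement[of V] \<V>(1) by blast
      then show "c \<in> part (\<Union>\<V>)" using V(1) by (auto simp: part_def)
    qed
  qed (use \<V> in auto)
qed

definition boundary_arcs :: "'v set \<Rightarrow> 'e set" where
  "boundary_arcs V = {e \<in> arcs G. tail G e \<in> V \<and> head G e \<notin> V}"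

lemma finite_boundary_arcs:
  assumes "finite V" "V \<subseteq> verts G"
  shows "finite (boundary_arcs V)"
proof (rule finite_subset)
  show "boundary_arcs V \<subseteq> (\<Union>v\<in>V. out_arcs G v)" by (auto simp: boundary_arcs_def)
  show "finite (\<Union>v\<in>V. out_arcs G v)" using assms finite_out_arcs by blast
qed

definition seam :: "'e \<Rightarrow> ('v \<times> 'm) set set" where
  "seam e = q (tail G e) ` S e"

text \<open>
  A class with representatives both over \<open>V\<close> and over its complement arises from an arc that leaves \<open>V\<close>.
\<close>

lemma part_Int_complement:
  assumes V: "V \<subseteq> verts G"
  shows "part V \<inter> part (verts G - V) = (\<Union>e\<in>boundary_arcs V. seam e)"
proof (intro set_eqI iffI)
  fix c assume c: "c \<in> part V \<inter> part (verts G - V)"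
  then obtain v x where vx: "v \<in> V" "x \<in> P v" "c = q v x" by (auto simp: part_def)
  with c mem_part_iff[of x v "verts G - V"] obtain e where
    "e \<in> out_arcs G v" "head G e \<in> verts G - V" "x \<in> S e" by auto
  with vx show "c \<in> (\<Union>e\<in>boundary_arcs V. seam e)"
    by (auto simp: boundary_arcs_def seam_def)
next
  fix c assume "c \<in> (\<Union>e\<in>boundary_arcs V. seam e)"
  then obtain e x where e: "e \<in> arcs G" "tail G e \<in> V" "head G e \<notin> V" "x \<in> S e" "c = q (tail G e) x"
    by (auto simp: boundary_arcs_def seam_def)
  then have "x \<in> P (tail G e)" using sphere_subset_piece by blast
  then show "c \<in> part V \<inter> part (verts G - V)"
    using e mem_part_iff[of x "tail G e"] by auto
qed

text \<open>
  A class on a seam between \<open>V\<close> and its complement has exactly one representative over \<open>V\<close>. Therefore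
  such seams are disjoint and are embedded copies of the boundary spheres. (For a loop of the graph,
  the two ends of the seam lie over the same vertex, and this representative would not be unique.)
\<close>

lemma boundary_seam_inj:
  assumes e: "e \<in> boundary_arcs V" "e' \<in> boundary_arcs V" and x: "x \<in> S e" "x' \<in> S e'"
    and eq: "q (tail G e) x = q (tail G e') x'"
  shows "e = e' \<and> x = x'"
proof -
  have arcs: "e \<in> arcs G" "e' \<in> arcs G" "head G e \<notin> V" "tail G e' \<in> V"
    using e by (auto simp: boundary_arcs_def)
  have "(tail G e', x') \<in> q (tail G e) x" unfolding eq by (rule glue_class_refl)
  then have "tail G e' = tail G e" "x' = x"
    using arcs glue_class_seam[OF arcs(1) x(1)] by auto
  then show ?thesis using sphere_unique[OF arcs(1,2)] x by auto
qed

lemma seam_parametrization: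
  assumes e: "e \<in> boundary_arcs V"
  shows "\<exists>s. continuous_map (top_of_set (sphere (0::real^3) 1)) Q s \<and> inj_on s (sphere 0 1) \<and>
             s ` sphere 0 1 = seam e"
proof -
  have arc: "e \<in> arcs G" using e by (simp add: boundary_arcs_def)
  then have v: "tail G e \<in> verts G" by simp
  obtain f :: "real^3 \<Rightarrow> 'm" where f: "continuous_map (top_of_set (sphere 0 1)) (mtop (X (tail G e))) f"
    "inj_on f (sphere 0 1)" "f ` sphere 0 1 = S e"
    using closed_3ball_boundary(2)[OF summand_smooth[OF v] closed_ball[OF arc]] unfolding bsphere_def by blast
  have "continuous_map (top_of_set (sphere 0 1)) (subtopology (mtop (X (tail G e))) (P (tail G e))) f"
    using f(1) by (rule continuous_map_into_subtopology) (use f(3) sphere_subset_piece[OF arc] in auto)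
  then have "continuous_map (top_of_set (sphere 0 1)) Q (q (tail G e) \<circ> f)"
    using continuous_map_glue[OF v] by (rule continuous_map_compose)
  moreover have "inj_on (q (tail G e) \<circ> f) (sphere 0 1)"
  proof (rule comp_inj_on[OF f(2)])
    show "inj_on (q (tail G e)) (f ` sphere 0 1)"
      unfolding f(3) by (rule inj_onI) (rule conjunct2[OF boundary_seam_inj[OF e e]])
  qed
  moreover have "(q (tail G e) \<circ> f) ` sphere 0 1 = seam e"
    by (simp only: image_comp[symmetric] f(3) seam_def)
  ultimately show ?thesis by (intro exI conjI)
qed

section \<open>The obstruction\<close>

text \<open>
  The pieces over a large finite set of vertices contain the core circle, the others a parallel circle
  far out, and the seams between them form a finite disjoint union of spheres.
\<close>

proposition glued_space_not_homeomorphic_R2_times_S1: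
  fixes h :: "(real^2) \<times> complex \<Rightarrow> ('v \<times> 'm) set"
  assumes hk: "homeomorphic_maps (top_of_set (UNIV \<times> sphere 0 1)) Q h k"
  shows False
proof -
  let ?M = "(UNIV :: (real^2) set) \<times> sphere (0::complex) 1"
  have k: "homeomorphic_map Q (top_of_set ?M) k"
    using hk unfolding homeomorphic_maps_map by (elim conjE)
  have h: "continuous_map (top_of_set ?M) Q h"
    using hk unfolding homeomorphic_maps_def by (elim conjE)
  have kh: "k (h p) = p" if "p \<in> ?M" for p
    using hk that unfolding homeomorphic_maps_def topspace_euclidean_subtopology by (elim conjE) (rule bspec)
  have inj_k: "inj_on k (topspace Q)" using k by (rule homeomorphic_imp_injective_map)
  have cont_k: "continuous_map Q (top_of_set ?M) k" using k by (rule homeomorphic_imp_continuous_map)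
  have closed_M: "closed ?M" by (intro closed_Times) auto
  let ?core = "{0 :: real^2} \<times> sphere (0::complex) 1"
  have "compactin (top_of_set ?M) ?core"
    by (auto simp: compactin_subtopology compact_Times)
  then have "compactin Q (h ` ?core)" using h by (rule image_compactin)
  then obtain V where V: "finite V" "V \<subseteq> verts G" "h ` ?core \<subseteq> part V"
    by (rule compactin_subset_part)
  let ?V' = "verts G - V"
  define A where "A = k ` part V"
  define B' where "B' = k ` part ?V'"
  have sub: "part V \<subseteq> topspace Q" "part ?V' \<subseteq> topspace Q"
    using part_Un_complement[OF V(2)] by auto
  have "compactin (top_of_set ?M) A"
    unfolding A_def using compactin_part[OF V(1,2)] cont_k by (rule image_compactin)
  then have A: "compact A" by (simp add: compactin_subtopology)
  have "closedin (top_of_set ?M) B'"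
    unfolding B'_def using closedin_part[of ?V'] homeomorphic_map_closedness[OF k sub(2)] by blast
  then have "closed B'" using closed_M by (rule closedin_closed_trans)
  have cover: "A \<union> B' = ?M"
    using homeomorphic_imp_surjective_map[OF k] part_Un_complement[OF V(2)]
    unfolding A_def B'_def by (simp add: image_Un[symmetric])
  have "?core \<subseteq> A"
  proof
    fix p assume p: "p \<in> ?core"
    then have "p = k (h p)" using kh[of p] by auto
    moreover have "h p \<in> part V" using V(3) p by blast
    ultimately show "p \<in> A" unfolding A_def by blast
  qed
  obtain r where r: "\<And>p. p \<in> A \<Longrightarrow> norm p \<le> r"
    using compact_imp_bounded[OF A] unfolding bounded_iff by blast
  obtain b :: "real^2" where b: "norm b = \<bar>r\<bar> + 1"
    using vector_choose_size[of "\<bar>r\<bar> + 1"] by auto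
  have "{b} \<times> sphere 0 1 \<subseteq> B'"
  proof
    fix p assume p: "p \<in> {b} \<times> sphere (0::complex) 1"
    then have "norm b \<le> norm p" using norm_fst_le[of b "snd p"] by auto
    then have "p \<notin> A" using r[of p] b by linarith
    moreover have "p \<in> A \<union> B'" unfolding cover using p by auto
    ultimately show "p \<in> B'" by blast
  qed
  have AB: "A \<inter> B' = \<Union> ((\<lambda>e. k ` seam e) ` boundary_arcs V)"
    unfolding A_def B'_def inj_on_image_Int[OF inj_k sub, symmetric] part_Int_complement[OF V(2)] by blast
  have seam_sub: "seam e \<subseteq> topspace Q" if "e \<in> boundary_arcs V" for e
    using part_Int_complement[OF V(2)] sub that by blast
  have "Borsukian (A \<inter> B')"
    unfolding AB
  proof (rule Borsukian_Union_disjoint)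
    show "finite ((\<lambda>e. k ` seam e) ` boundary_arcs V)"
      using finite_boundary_arcs[OF V(1,2)] by simp
    show "disjoint ((\<lambda>e. k ` seam e) ` boundary_arcs V)"
    proof (rule pairwise_imageI)
      fix e e' assume e: "e \<in> boundary_arcs V" "e' \<in> boundary_arcs V" "e \<noteq> e'"
      then have "seam e \<inter> seam e' = {}"
        using boundary_seam_inj[OF e(1,2)] unfolding seam_def by blast
      then show "disjnt (k ` seam e) (k ` seam e')"
        using inj_on_image_Int[OF inj_k seam_sub[OF e(1)] seam_sub[OF e(2)]] by (simp add: disjnt_def)
    qed
    fix C assume "C \<in> (\<lambda>e. k ` seam e) ` boundary_arcs V"
    then obtain e where e: "e \<in> boundary_arcs V" "C = k ` seam e" by blast
    obtain s where s: "continuous_map (top_of_set (sphere (0::real^3) 1)) Q s"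
      "inj_on s (sphere 0 1)" "s ` sphere 0 1 = seam e"
      using seam_parametrization[OF e(1)] by blast
    have "continuous_map (top_of_set (sphere 0 1)) (top_of_set ?M) (k \<circ> s)"
      using s(1) cont_k by (rule continuous_map_compose)
    then have cont: "continuous_on (sphere 0 1) (k \<circ> s)"
      by (simp add: continuous_map_in_subtopology)
    have im: "(k \<circ> s) ` sphere 0 1 = C"
      by (simp only: image_comp[symmetric] s(3) e(2))
    have "inj_on (k \<circ> s) (sphere 0 1)"
      using s(2) inj_on_subset[OF inj_k seam_sub[OF e(1)]] unfolding s(3)[symmetric] by (rule comp_inj_on)
    with cont im have "sphere (0::real^3) 1 homeomorphic C"
      by (intro homeomorphic_compact) auto
    moreover have "Borsukian (sphere (0::real^3) 1)"
      by (rule Borsukian_sphere) simp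
    ultimately show "Borsukian C" by (rule homeomorphic_Borsukian[rotated])
    have "compact C" using cont im compact_continuous_image[of "sphere 0 1" "k \<circ> s"] by simp
    then show "closed C" by (rule compact_imp_closed)
  qed
  then show False
    using Borsukian_separator_impossible[of A B' 0 b] compact_imp_closed[OF A] \<open>closed B'\<close> cover
      \<open>?core \<subseteq> A\<close> \<open>{b} \<times> sphere 0 1 \<subseteq> B'\<close> by blast
qed

end

theorem proposition8p2:
  fixes G :: "('v, 'e) pre_digraph" and arev :: "'e \<Rightarrow> 'e"
  assumes "locally_finite_graph G arev"
  shows "\<not> connected_sum_decomposition G arev
            {X :: 'm manifold3. spherical_manifold X \<or> S2_times_S1_manifold X}
            R2_times_S1"
proof
  assume "connected_sum_decomposition G arev
            {X :: 'm manifold3. spherical_manifold X \<or> S2_times_S1_manifold X} R2_times_S1"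
  then obtain X :: "'v \<Rightarrow> 'm manifold3" and B g Z where
    X: "\<forall>v\<in>verts G. X v \<in> {X. spherical_manifold X \<or> S2_times_S1_manifold X} \<and> oriented_manifold3 (X v)"
    and balls: "disjoint_balls G X B" and glue: "gluing_maps G arev X B g"
    and Z: "glued_manifold G X B g Z" "diffeomorphic R2_times_S1 Z"
    unfolding connected_sum_decomposition_def by blast
  interpret bidirected_digraph G arev
    using assms by (simp add: locally_finite_graph_def)
  interpret ball_gluing G arev X B g
  proof
    fix v assume v: "v \<in> verts G"
    show "finite (out_arcs G v)" using assms v by (simp add: locally_finite_graph_def)
    show "smooth_manifold3 (X v)" using X v by (simp add: oriented_manifold3_def)
    show "compact_space (mtop (X v))" using X v by (simp add: compact_space_summand)
  qed (rule balls glue)+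
  have "mtop (R2_times_S1) homeomorphic_space mtop Z"
    using Z submanifold3_topological_charts smooth_manifold3_topological_charts
    unfolding R2_times_S1_def glued_manifold_def by (intro diffeomorphic_imp_homeomorphic_space) auto
  moreover have "mtop Z = glued_space G X B g" using Z(1) by (simp add: glued_manifold_def)
  ultimately obtain h k where
    "homeomorphic_maps (top_of_set ((UNIV :: (real^2) set) \<times> sphere (0::complex) 1)) (glued_space G X B g) h k"
    unfolding homeomorphic_space_def R2_times_S1_def submanifold3_def by auto
  then show False by (rule glued_space_not_homeomorphic_R2_times_S1)
qed

end
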